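(* Let $\mathcal{G}$ be a compact, connected metric graph with a nonempty set $\mathcal{V}_D$ of Dirichlet vertices, let $\alpha\in(0,1)$, and let $u_\alpha\in H_0^\alpha(\mathcal{G})$ be the fractional torsion function of $\mathcal{G}$. Then the fractional torsional rigidity $T_\alpha(\mathcal{G})$ satisfies $$T_{\alpha}(\mathcal{G})= \sup_{0\neq f \in H_0^\alpha(\mathcal{G})}\frac{\left( \int_{\mathcal{G}} f(x)\, dx\right) ^2}{\langle f, (-\Delta_{\mathcal{G}})^\alpha f \rangle }=\max_{0\neq f \in H_0^\alpha(\mathcal{G})}\frac{\left( \int_{\mathcal{G}} f(x)\, dx\right) ^2}{\langle f, (-\Delta_{\mathcal{G}})^\alpha f \rangle }.$$ Moreover, the supremum is attained at every nonzero constant multiple of $u_\alpha$.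
   Context: A compact metric graph $\mathcal{G}$ is obtained from a finite graph with vertex set $\mathcal{V}$ and edge set $\mathcal{E}$ (loops and parallel edges allowed) by identifying each edge $e$ with an interval $[0,\ell_e]$, $0<\ell_e<\infty$, and gluing endpoints according to the graph structure. Its total length is $|\mathcal{G}|=\sum_{e}\ell_e$. A nonempty set $\mathcal{V}_D\subseteq\mathcal{V}$ of Dirichlet vertices is fixed. $L^2(\mathcal{G})=\bigoplus_{e}L^2(0,\ell_e)$ with inner product $\langle\cdot,\cdot\rangle$; functions are real-valued. The Laplacian $-\Delta_{\mathcal{G}}$ acts as $-f_e''$ on each edge, with domain the edgewise $H^2$ functions that are continuous at every vertex, vanish at every $v\in\mathcal{V}_D$, and at every $v\in\mathcal{V}\setminus\mathcal{V}_D$ satisfy the Kirchhoff condition: the sum, over all edge ends incident to $v$, of the derivatives at $v$ taken in the direction pointing into $v$, is zero. It is self-adjoint with compact resolvent, with eigenvalues $0<\lambda_1\le\lambda_2\le\cdots\to\infty$ (with multiplicity) and an $L^2$-orthonormal basis of eigenfunctions $\varphi_n$. For $\alpha\in(0,1)$, $(-\Delta_{\mathcal{G}})^\alpha f=\sum_n\lambda_n^\alpha\langle f,\varphi_n\rangle\varphi_n$ on the domain $\{f\in L^2(\mathcal{G}):\sum_n\lambda_n^{2\alpha}|\langle f,\varphi_n\rangle|^2<\infty\}$. The fractional torsion function $u_\alpha$ is the unique solution of $(-\Delta_{\mathcal{G}})^\alpha u_\alpha=1$, i.e. $u_\alpha=\sum_n\lambda_n^{-\alpha}\langle 1,\varphi_n\rangle\varphi_n$,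 and the fractional torsional rigidity is $T_\alpha(\mathcal{G})=\int_{\mathcal{G}}u_\alpha\,dx$. The fractional Sobolev space is $H_0^\alpha(\mathcal{G})=\{u\in L^2(\mathcal{G}):\sum_n\lambda_n^\alpha|\langle u,\varphi_n\rangle|^2<\infty\}$, the vanishing on $\mathcal{V}_D$ being understood in the spectral sense, i.e. encoded in the eigenbasis. For $f\in H_0^\alpha(\mathcal{G})$, $\langle f,(-\Delta_{\mathcal{G}})^\alpha f\rangle$ denotes the quadratic form $\sum_n\lambda_n^\alpha|\langle f,\varphi_n\rangle|^2$. *)

theory Defs
  imports "HOL-Analysis.Analysis" "Graph_Theory.Digraph_Component"
begin

text \<open>
  The orientation of an arc only fixes its parametrisation: the arc \<open>e\<close> is the interval
  \<open>[0, edge_length e]\<close>, with \<open>0\<close> glued to \<open>tail e\<close> and \<open>edge_length e\<close> glued to \<open>head e\<close>.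
  Connectedness is \<^const>\<open>Digraph_Component.connected\<close>, that is, connectedness of the
  underlying undirected multigraph.
\<close>

record ('v, 'e) metric_graph =
  skeleton :: "('v, 'e) pre_digraph"
  edge_length :: "'e \<Rightarrow> real"
  dirichlet :: "'v set"

abbreviation edges :: "('v, 'e) metric_graph \<Rightarrow> 'e set" where
  "edges G \<equiv> arcs (skeleton G)"

definition compact_metric_graph :: "('v, 'e) metric_graph \<Rightarrow> bool" where
  "compact_metric_graph G \<longleftrightarrow>
     fin_digraph (skeleton G) \<and> (\<forall>e\<in>edges G. 0 < edge_length G e) \<and>
     dirichlet G \<subseteq> verts (skeleton G)"

text \<open>
  A real function on the graph is given edgewise, as \<open>f :: 'e \<Rightarrow> real \<Rightarrow> real\<close>; only its values
  \<open>f e x\<close> with \<open>e \<in> edges G\<close> and \<open>0 \<le> x \<le> edge_length G e\<close> matter. Elements of \<open>L\<^sup>2\<close> are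
  represented by functions, not by classes modulo null sets.
\<close>

abbreviation edge_measure :: "('v, 'e) metric_graph \<Rightarrow> 'e \<Rightarrow> real measure" where
  "edge_measure G e \<equiv> lebesgue_on {0..edge_length G e}"

definition L2_interval :: "real \<Rightarrow> (real \<Rightarrow> real) set" where
  "L2_interval l = {f. f \<in> borel_measurable (lebesgue_on {0..l}) \<and>
                       integrable (lebesgue_on {0..l}) (\<lambda>x. (f x)\<^sup>2)}"

definition L2 :: "('v, 'e) metric_graph \<Rightarrow> ('e \<Rightarrow> real \<Rightarrow> real) set" where
  "L2 G = {f. \<forall>e\<in>edges G. f e \<in> L2_interval (edge_length G e)}"

definition L2_inner ::
    "('v, 'e) metric_graph \<Rightarrow> ('e \<Rightarrow> real \<Rightarrow> real) \<Rightarrow> ('e \<Rightarrow> real \<Rightarrow> real) \<Rightarrow> real" where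
  "L2_inner G f g = (\<Sum>e\<in>edges G. LINT x|edge_measure G e. f e x * g e x)"

definition graph_integral :: "('v, 'e) metric_graph \<Rightarrow> ('e \<Rightarrow> real \<Rightarrow> real) \<Rightarrow> real" where
  "graph_integral G f = (\<Sum>e\<in>edges G. LINT x|edge_measure G e. f e x)"

definition AE_equal ::
    "('v, 'e) metric_graph \<Rightarrow> ('e \<Rightarrow> real \<Rightarrow> real) \<Rightarrow> ('e \<Rightarrow> real \<Rightarrow> real) \<Rightarrow> bool" where
  "AE_equal G f g \<longleftrightarrow> (\<forall>e\<in>edges G. AE x in edge_measure G e. f e x = g e x)"

text \<open>Convergence of a series in the norm of \<open>L\<^sup>2\<close>.\<close>

definition L2_sums ::
    "('v, 'e) metric_graph \<Rightarrow> (nat \<Rightarrow> 'e \<Rightarrow> real \<Rightarrow> real) \<Rightarrow> ('e \<Rightarrow> real \<Rightarrow> real) \<Rightarrow> bool" where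
  "L2_sums G h f \<longleftrightarrow> (\<forall>n. h n \<in> L2 G) \<and> f \<in> L2 G \<and>
     (\<lambda>N. let r = (\<lambda>e x. f e x - (\<Sum>n<N. h n e x)) in sqrt (L2_inner G r r)) \<longlonglongrightarrow> 0"

text \<open>
  \<open>f\<close> is the \<open>C\<^sup>1\<close> representative of an element of the Sobolev space \<open>H\<^sup>2(0, l)\<close>, with derivative
  \<open>f'\<close> (one-sided at the end points) and weak second derivative \<open>f''\<close>: the function \<open>f'\<close> is
  absolutely continuous with density \<open>f'' \<in> L\<^sup>2(0, l)\<close>.
\<close>

definition H2_interval :: "real \<Rightarrow> (real \<Rightarrow> real) \<Rightarrow> (real \<Rightarrow> real) \<Rightarrow> (real \<Rightarrow> real) \<Rightarrow> bool" where
  "H2_interval l f f' f'' \<longleftrightarrow>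
     f'' \<in> L2_interval l \<and>
     (\<forall>x\<in>{0..l}. (f has_real_derivative f' x) (at x within {0..l})) \<and>
     (\<forall>x\<in>{0..l}. f' x = f' 0 + (LINT t|lebesgue_on {0..x}. f'' t))"

text \<open>
  The edge ends at a vertex; \<open>(e, False)\<close> is the end of \<open>e\<close> at parameter \<open>0\<close>, and \<open>(e, True)\<close> the one
  at parameter \<open>edge_length e\<close>. A loop contributes both of its ends.
\<close>

definition ends_at :: "('v, 'e) metric_graph \<Rightarrow> 'v \<Rightarrow> ('e \<times> bool) set" where
  "ends_at G v = {(e, b). e \<in> edges G \<and>
                          (if b then head (skeleton G) e else tail (skeleton G) e) = v}"

fun end_value :: "('v, 'e) metric_graph \<Rightarrow> ('e \<Rightarrow> real \<Rightarrow> real) \<Rightarrow> 'e \<times> bool \<Rightarrow> real" where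
  "end_value G f (e, b) = f e (if b then edge_length G e else 0)"

text \<open>From edgewise derivatives \<open>f'\<close>, the derivative in the direction pointing into the vertex.\<close>

fun inward_deriv :: "('v, 'e) metric_graph \<Rightarrow> ('e \<Rightarrow> real \<Rightarrow> real) \<Rightarrow> 'e \<times> bool \<Rightarrow> real" where
  "inward_deriv G f' (e, b) = (if b then f' e (edge_length G e) else - f' e 0)"

text \<open>
  The graph of the operator \<open>- \<Delta>\<close>: \<open>f\<close> is the (edgewise \<open>C\<^sup>1\<close>) representative of a function in the
  domain and \<open>g\<close> represents \<open>- \<Delta> f\<close>.
\<close>

definition neg_laplacian ::
    "('v, 'e) metric_graph \<Rightarrow> ('e \<Rightarrow> real \<Rightarrow> real) \<Rightarrow> ('e \<Rightarrow> real \<Rightarrow> real) \<Rightarrow> bool" where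
  "neg_laplacian G f g \<longleftrightarrow> (\<exists>f' f''.
     (\<forall>e\<in>edges G. H2_interval (edge_length G e) (f e) (f' e) (f'' e)) \<and>
     (\<forall>v\<in>verts (skeleton G). \<forall>p\<in>ends_at G v. \<forall>q\<in>ends_at G v. end_value G f p = end_value G f q) \<and>
     (\<forall>v\<in>dirichlet G. \<forall>p\<in>ends_at G v. end_value G f p = 0) \<and>
     (\<forall>v\<in>verts (skeleton G) - dirichlet G. (\<Sum>p\<in>ends_at G v. inward_deriv G f' p) = 0) \<and>
     AE_equal G g (\<lambda>e x. - f'' e x))"

text \<open>
  \<open>lam n\<close> and \<open>phi n\<close> (indexed from \<open>0\<close>) are the eigenvalues in nondecreasing order, repeated
  according to multiplicity, and a corresponding orthonormal basis of \<open>L\<^sup>2\<close>. That the eigenvalues are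
  positive and unbounded is a consequence, and is not part of the definition.
\<close>

definition laplacian_eigenbasis ::
    "('v, 'e) metric_graph \<Rightarrow> (nat \<Rightarrow> real) \<Rightarrow> (nat \<Rightarrow> 'e \<Rightarrow> real \<Rightarrow> real) \<Rightarrow> bool" where
  "laplacian_eigenbasis G lam phi \<longleftrightarrow>
     incseq lam \<and>
     (\<forall>n. neg_laplacian G (phi n) (\<lambda>e x. lam n * phi n e x)) \<and>
     (\<forall>m n. L2_inner G (phi m) (phi n) = (if m = n then 1 else 0)) \<and>
     (\<forall>f\<in>L2 G. L2_sums G (\<lambda>n e x. L2_inner G f (phi n) * phi n e x) f)"

definition frac_laplacian_domain ::
    "('v, 'e) metric_graph \<Rightarrow> (nat \<Rightarrow> real) \<Rightarrow> (nat \<Rightarrow> 'e \<Rightarrow> real \<Rightarrow> real) \<Rightarrow> real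
      \<Rightarrow> ('e \<Rightarrow> real \<Rightarrow> real) set" where
  "frac_laplacian_domain G lam phi \<alpha> =
     {f \<in> L2 G. summable (\<lambda>n. lam n powr (2 * \<alpha>) * (L2_inner G f (phi n))\<^sup>2)}"

text \<open>The graph of the operator \<open>(- \<Delta>)\<^sup>\<alpha>\<close>: \<open>g\<close> represents \<open>(- \<Delta>)\<^sup>\<alpha> f\<close>.\<close>

definition frac_laplacian ::
    "('v, 'e) metric_graph \<Rightarrow> (nat \<Rightarrow> real) \<Rightarrow> (nat \<Rightarrow> 'e \<Rightarrow> real \<Rightarrow> real) \<Rightarrow> real
      \<Rightarrow> ('e \<Rightarrow> real \<Rightarrow> real) \<Rightarrow> ('e \<Rightarrow> real \<Rightarrow> real) \<Rightarrow> bool" where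
  "frac_laplacian G lam phi \<alpha> f g \<longleftrightarrow>
     f \<in> frac_laplacian_domain G lam phi \<alpha> \<and>
     L2_sums G (\<lambda>n e x. lam n powr \<alpha> * L2_inner G f (phi n) * phi n e x) g"

text \<open>The solution is unique as an element of \<open>L\<^sup>2\<close>; the choice is that of a representative.\<close>

definition frac_torsion_function ::
    "('v, 'e) metric_graph \<Rightarrow> (nat \<Rightarrow> real) \<Rightarrow> (nat \<Rightarrow> 'e \<Rightarrow> real \<Rightarrow> real) \<Rightarrow> real
      \<Rightarrow> 'e \<Rightarrow> real \<Rightarrow> real" where
  "frac_torsion_function G lam phi \<alpha> = (SOME u. frac_laplacian G lam phi \<alpha> u (\<lambda>e x. 1))"

definition frac_torsional_rigidity ::
    "('v, 'e) metric_graph \<Rightarrow> (nat \<Rightarrow> real) \<Rightarrow> (nat \<Rightarrow> 'e \<Rightarrow> real \<Rightarrow> real) \<Rightarrow> real \<Rightarrow> real" where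
  "frac_torsional_rigidity G lam phi \<alpha> = graph_integral G (frac_torsion_function G lam phi \<alpha>)"

definition H0_frac ::
    "('v, 'e) metric_graph \<Rightarrow> (nat \<Rightarrow> real) \<Rightarrow> (nat \<Rightarrow> 'e \<Rightarrow> real \<Rightarrow> real) \<Rightarrow> real
      \<Rightarrow> ('e \<Rightarrow> real \<Rightarrow> real) set" where
  "H0_frac G lam phi \<alpha> = {f \<in> L2 G. summable (\<lambda>n. lam n powr \<alpha> * (L2_inner G f (phi n))\<^sup>2)}"

definition frac_form ::
    "('v, 'e) metric_graph \<Rightarrow> (nat \<Rightarrow> real) \<Rightarrow> (nat \<Rightarrow> 'e \<Rightarrow> real \<Rightarrow> real) \<Rightarrow> real
      \<Rightarrow> ('e \<Rightarrow> real \<Rightarrow> real) \<Rightarrow> real" where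
  "frac_form G lam phi \<alpha> f = (\<Sum>n. lam n powr \<alpha> * (L2_inner G f (phi n))\<^sup>2)"

definition polya_quotient ::
    "('v, 'e) metric_graph \<Rightarrow> (nat \<Rightarrow> real) \<Rightarrow> (nat \<Rightarrow> 'e \<Rightarrow> real \<Rightarrow> real) \<Rightarrow> real
      \<Rightarrow> ('e \<Rightarrow> real \<Rightarrow> real) \<Rightarrow> real" where
  "polya_quotient G lam phi \<alpha> f = (graph_integral G f)\<^sup>2 / frac_form G lam phi \<alpha> f"

text \<open>Nonzero is meant in \<open>L\<^sup>2\<close>, that is, not almost everywhere zero.\<close>

definition admissible ::
    "('v, 'e) metric_graph \<Rightarrow> (nat \<Rightarrow> real) \<Rightarrow> (nat \<Rightarrow> 'e \<Rightarrow> real \<Rightarrow> real) \<Rightarrow> real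
      \<Rightarrow> ('e \<Rightarrow> real \<Rightarrow> real) set" where
  "admissible G lam phi \<alpha> = {f \<in> H0_frac G lam phi \<alpha>. \<not> AE_equal G f (\<lambda>e x. 0)}"

end

theory Submission
  imports Defs
begin

text \<open>
  Integrating by parts on the edges, with the vertex conditions cancelling the boundary terms, a
  normalised eigenfunction satisfies \<open>\<lambda> = \<Sum>\<^sub>e \<integral> \<phi>'\<^sup>2\<close>; if this vanished, \<open>\<phi>\<close> would be constant on
  each edge, and connectedness would propagate the value \<open>0\<close> from a Dirichlet vertex to the whole
  graph. So all eigenvalues are positive, and the coefficients \<open>\<lambda>\<^sub>n\<^sup>-\<^sup>\<alpha> \<langle>1, \<phi>\<^sub>n\<rangle>\<close> define the torsion
  function \<open>u\<close> by Riesz--Fischer. The equation of \<open>u\<close> says that \<open>\<integral> f\<close> is the value at \<open>(f, u)\<close> of the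
  bilinear form of \<open>(- \<Delta>)\<^sup>\<alpha>\<close>, so the Cauchy--Schwarz inequality for this form bounds the
  quotient by \<open>\<integral> u\<close>, with equality at the nonzero multiples of \<open>u\<close>.
\<close>

section \<open>Square integrable functions\<close>

lemma square_integrable_mult:
  fixes f g :: "'a \<Rightarrow> real"
  assumes [measurable]: "f \<in> borel_measurable M" "g \<in> borel_measurable M"
    and "integrable M (\<lambda>x. (f x)\<^sup>2)" "integrable M (\<lambda>x. (g x)\<^sup>2)"
  shows "integrable M (\<lambda>x. f x * g x)"
proof (rule Bochner_Integration.integrable_bound)
  show "integrable M (\<lambda>x. (f x)\<^sup>2 + (g x)\<^sup>2)"
    using assms by simp
  show "AE x in M. norm (f x * g x) \<le> norm ((f x)\<^sup>2 + (g x)\<^sup>2)"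
  proof (rule AE_I2)
    fix x
    have "2 * (\<bar>f x\<bar> * \<bar>g x\<bar>) \<le> (f x)\<^sup>2 + (g x)\<^sup>2"
      using sum_squares_bound[of "\<bar>f x\<bar>" "\<bar>g x\<bar>"] by (simp add: mult.assoc)
    moreover have "0 \<le> \<bar>f x\<bar> * \<bar>g x\<bar>" by simp
    ultimately have "\<bar>f x\<bar> * \<bar>g x\<bar> \<le> (f x)\<^sup>2 + (g x)\<^sup>2" by linarith
    then show "norm (f x * g x) \<le> norm ((f x)\<^sup>2 + (g x)\<^sup>2)"
      by (simp add: abs_mult)
  qed
qed simp

lemma square_integrable_add:
  fixes f g :: "'a \<Rightarrow> real"
  assumes "f \<in> borel_measurable M" "g \<in> borel_measurable M"
    and "integrable M (\<lambda>x. (f x)\<^sup>2)" "integrable M (\<lambda>x. (g x)\<^sup>2)"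
  shows "integrable M (\<lambda>x. (f x + g x)\<^sup>2)"
proof -
  have "integrable M (\<lambda>x. (f x)\<^sup>2 + (g x)\<^sup>2 + 2 * (f x * g x))"
    using assms square_integrable_mult[OF assms] by simp
  then show ?thesis by (simp add: power2_sum mult.assoc)
qed

text \<open>Classical completeness argument: along a subsequence the increments have geometrically
  small norm, finiteness of the measure makes their sum integrable, so the subsequence converges
  almost everywhere, and Fatou's lemma bounds the distance of the whole sequence from the
  limit.\<close>

lemma (in finite_measure) square_integrable_complete:
  fixes s :: "nat \<Rightarrow> 'a \<Rightarrow> real"
  assumes meas[measurable]: "\<And>n. s n \<in> borel_measurable M"
    and sqi: "\<And>n. integrable M (\<lambda>x. (s n x)\<^sup>2)"
    and Cauchy: "\<And>\<epsilon>. 0 < \<epsilon> \<Longrightarrow> \<exists>N. \<forall>m\<ge>N. \<forall>n\<ge>N. (\<integral>x. (s m x - s n x)\<^sup>2 \<partial>M) < \<epsilon>"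
  obtains f where "f \<in> borel_measurable M" "integrable M (\<lambda>x. (f x)\<^sup>2)"
    "(\<lambda>n. \<integral>x. (f x - s n x)\<^sup>2 \<partial>M) \<longlonglongrightarrow> 0"
proof -
  have sqd: "integrable M (\<lambda>x. (s m x - s n x)\<^sup>2)" for m n
    using square_integrable_add[of "s m" M "\<lambda>x. - s n x"] sqi by simp
  have "\<exists>N. \<forall>k. \<forall>m\<ge>N k. \<forall>n\<ge>N k. (\<integral>x. (s m x - s n x)\<^sup>2 \<partial>M) < (1/4)^k"
    by (rule choice) (use Cauchy in auto)
  then obtain N where
    N: "\<And>k m n. m \<ge> N k \<Longrightarrow> n \<ge> N k \<Longrightarrow> (\<integral>x. (s m x - s n x)\<^sup>2 \<partial>M) < (1/4)^k" by blast
  \<comment> \<open>A partial sum dominates each of its terms, so \<open>r k\<close> lies beyond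
    every threshold \<open>N j\<close> with \<open>j \<le> k\<close>. Repeated indices are
    harmless.\<close>
  define r where "r k = (\<Sum>j\<le>k. N j)" for k
  have r: "N j \<le> r k" if "j \<le> k" for j k
    unfolding r_def using that by (intro member_le_sum) auto
  define d where "d k x = s (r (Suc k)) x - s (r k) x" for k x
  have [measurable]: "d k \<in> borel_measurable M" for k
    unfolding d_def by measurable
  have dsq: "integrable M (\<lambda>x. (d k x)\<^sup>2)" and dlt: "(\<integral>x. (d k x)\<^sup>2 \<partial>M) \<le> (1/4)^k" for k
    unfolding d_def using sqd N[of k "r (Suc k)" "r k"] r by (auto simp: less_imp_le)
  \<comment> \<open>This is \<open>y \<le> y^2 + 1\<close> for \<open>y = 2^k * |d k x|\<close>,
    divided by \<open>2^k\<close>. Since the square of \<open>d k\<close> integrates to at most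
    \<open>(1/4)^k\<close>, this weight makes both summands integrate to order
    \<open>(1/2)^k\<close>.\<close>
  have dbound: "\<bar>d k x\<bar> \<le> 2^k * (d k x)\<^sup>2 + (1/2)^k" for k x
  proof -
    have eq: "2^k * (1/2)^k = (1::real)"
      by (simp flip: power_mult_distrib)
    have "2 * (2^k * \<bar>d k x\<bar>) \<le> (2^k * \<bar>d k x\<bar>)\<^sup>2 + 1"
      using sum_squares_bound[of "2^k * \<bar>d k x\<bar>" 1] by (simp only: power_one mult_1_right)
    moreover have "0 \<le> 2^k * \<bar>d k x\<bar>" by simp
    ultimately have "2^k * \<bar>d k x\<bar> \<le> (2^k * \<bar>d k x\<bar>)\<^sup>2 + 1" by linarith
    also have "\<dots> = 2^k * (2^k * (d k x)\<^sup>2 + (1/2)^k)"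
      using eq by (simp add: power_mult_distrib power2_eq_square distrib_left)
    finally show ?thesis by (simp only: mult_le_cancel_left_pos zero_less_power zero_less_numeral)
  qed
  have d_nn: "(\<integral>\<^sup>+x. ennreal \<bar>d k x\<bar> \<partial>M) \<le> ennreal ((1/2)^k * (1 + measure M (space M)))" for k
  proof -
    have int: "integrable M (\<lambda>x. 2^k * (d k x)\<^sup>2 + (1/2)^k)"
      using dsq by simp
    have "(\<integral>\<^sup>+x. ennreal \<bar>d k x\<bar> \<partial>M) \<le> (\<integral>\<^sup>+x. ennreal (2^k * (d k x)\<^sup>2 + (1/2)^k) \<partial>M)"
      by (intro nn_integral_mono ennreal_leI dbound)
    also have "\<dots> = ennreal (\<integral>x. 2^k * (d k x)\<^sup>2 + (1/2)^k \<partial>M)"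
      by (rule nn_integral_eq_integral[OF int]) simp
    also have "(\<integral>x. 2^k * (d k x)\<^sup>2 + (1/2)^k \<partial>M) = 2^k * (\<integral>x. (d k x)\<^sup>2 \<partial>M) + (1/2)^k * measure M (space M)"
      using dsq by simp
    also have "\<dots> \<le> 2^k * (1/4)^k + (1/2)^k * measure M (space M)"
      using dlt by simp
    also have "\<dots> = (1/2)^k * (1 + measure M (space M))"
      by (simp add: distrib_left flip: power_mult_distrib)
    finally show ?thesis by (simp add: ennreal_leI)
  qed
  \<comment> \<open>The sum of all absolute increments has finite integral, hence is finite almost
    everywhere; there the telescoping series converges.\<close>
  have "(\<integral>\<^sup>+x. (\<Sum>k. ennreal \<bar>d k x\<bar>) \<partial>M) = (\<Sum>k. \<integral>\<^sup>+x. ennreal \<bar>d k x\<bar> \<partial>M)"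
    by (rule nn_integral_suminf) simp
  also have "\<dots> \<le> (\<Sum>k. ennreal ((1/2)^k * (1 + measure M (space M))))"
    by (intro suminf_le d_nn summableI)
  also have "\<dots> < \<infinity>"
    by (subst suminf_ennreal2) (auto intro!: summable_mult2 summable_geometric)
  finally have "AE x in M. (\<Sum>k. ennreal \<bar>d k x\<bar>) \<noteq> \<infinity>"
    by (intro nn_integral_noteq_infinite) auto
  then have conv: "AE x in M. convergent (\<lambda>k. s (r k) x)"
  proof eventually_elim
    case (elim x)
    then have "summable (\<lambda>k. \<bar>d k x\<bar>)"
      by (intro summable_suminf_not_top) auto
    then have "summable (\<lambda>k. d k x)"
      by (rule summable_rabs_cancel)
    then have "convergent (\<lambda>n. s (r n) x - s (r 0) x)"
      unfolding d_def summable_iff_convergent using sum_lessThan_telescope[of "\<lambda>k. s (r k) x"] by simp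
    then have "convergent (\<lambda>n. (s (r n) x - s (r 0) x) + s (r 0) x)"
      by (intro convergent_add convergent_const)
    then show ?case by simp
  qed
  \<comment> \<open>Where the subsequence diverges, \<open>lim\<close> takes an unspecified value;
    this affects only a null set.\<close>
  define f where "f x = lim (\<lambda>k. s (r k) x)" for x
  have f[measurable]: "f \<in> borel_measurable M"
    unfolding f_def by measurable
  \<comment> \<open>With \<open>n\<close> fixed, Fatou's lemma is applied along the subsequence; for
    \<open>k \<ge> j\<close> both \<open>n\<close> and \<open>r k\<close> lie beyond
    \<open>N j\<close>.\<close>
  have fatou: "(\<integral>\<^sup>+x. ennreal ((f x - s n x)\<^sup>2) \<partial>M) \<le> ennreal ((1/4)^j)" if "n \<ge> N j" for n j
  proof -
    have "(\<integral>\<^sup>+x. ennreal ((f x - s n x)\<^sup>2) \<partial>M)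
        = (\<integral>\<^sup>+x. liminf (\<lambda>k. ennreal ((s (r k) x - s n x)\<^sup>2)) \<partial>M)"
    proof (rule nn_integral_cong_AE, use conv in eventually_elim)
      case (elim x)
      then have "(\<lambda>k. s (r k) x) \<longlonglongrightarrow> f x"
        unfolding f_def by (simp add: convergent_LIMSEQ_iff)
      then have "(\<lambda>k. ennreal ((s (r k) x - s n x)\<^sup>2)) \<longlonglongrightarrow> ennreal ((f x - s n x)\<^sup>2)"
        by (intro tendsto_intros)
      then show ?case
        by (rule lim_imp_Liminf[OF sequentially_bot, symmetric])
    qed
    also have "\<dots> \<le> liminf (\<lambda>k. \<integral>\<^sup>+x. ennreal ((s (r k) x - s n x)\<^sup>2) \<partial>M)"
      by (rule nn_integral_liminf) simp
    also have "\<dots> \<le> liminf (\<lambda>k. ennreal ((1/4)^j))"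
    proof (rule Liminf_mono, rule eventually_sequentiallyI[of j])
      fix k assume "j \<le> k"
      then have "(\<integral>x. (s (r k) x - s n x)\<^sup>2 \<partial>M) \<le> (1/4)^j"
        using N[of j "r k" n] r that by (simp add: less_imp_le)
      then show "(\<integral>\<^sup>+x. ennreal ((s (r k) x - s n x)\<^sup>2) \<partial>M) \<le> ennreal ((1/4)^j)"
        by (subst nn_integral_eq_integral[OF sqd]) (auto intro: ennreal_leI)
    qed
    finally show ?thesis by (simp add: Liminf_const)
  qed
  have fsq: "integrable M (\<lambda>x. (f x - s n x)\<^sup>2)" if "n \<ge> N j" for n j
    using fatou[OF that] by (intro integrableI_bounded) (auto intro: le_less_trans)
  have "integrable M (\<lambda>x. (f x)\<^sup>2)"
    using square_integrable_add[of "\<lambda>x. f x - s (N 0) x" M "s (N 0)"] fsq[of 0 "N 0"] sqi by simp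
  moreover have "(\<lambda>n. \<integral>x. (f x - s n x)\<^sup>2 \<partial>M) \<longlonglongrightarrow> 0"
  proof (rule LIMSEQ_I)
    fix \<epsilon> :: real assume "0 < \<epsilon>"
    then obtain j where j: "(1/4)^j < \<epsilon>"
      using real_arch_pow_inv[of \<epsilon> "1/4"] by auto
    have "norm ((\<integral>x. (f x - s n x)\<^sup>2 \<partial>M) - 0) < \<epsilon>" if "n \<ge> N j" for n
    proof -
      have "ennreal (\<integral>x. (f x - s n x)\<^sup>2 \<partial>M) \<le> ennreal ((1/4)^j)"
        using fatou[OF that] by (subst (asm) nn_integral_eq_integral[OF fsq[OF that]]) auto
      then show ?thesis using j by (simp add: integral_nonneg_AE)
    qed
    then show "\<exists>no. \<forall>n\<ge>no. norm ((\<integral>x. (f x - s n x)\<^sup>2 \<partial>M) - 0) < \<epsilon>" by blast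
  qed
  ultimately show ?thesis using f that by blast
qed

section \<open>Square integrable functions on an edge and on the graph, and their inner
  product\<close>

lemma H2_interval_continuous: "H2_interval l f f' f'' \<Longrightarrow> continuous_on {0..l} f"
  unfolding H2_interval_def by (meson DERIV_continuous continuous_on_eq_continuous_within)

lemma L2_interval_continuous: "continuous_on {0..l} f \<Longrightarrow> f \<in> L2_interval l"
  unfolding L2_interval_def
  by (auto intro!: continuous_imp_measurable_on_sets_lebesgue continuous_imp_integrable_real
      continuous_intros)

lemma L2_interval_mult_integrable:
  "f \<in> L2_interval l \<Longrightarrow> g \<in> L2_interval l \<Longrightarrow> integrable (lebesgue_on {0..l}) (\<lambda>x. f x * g x)"
  unfolding L2_interval_def by (blast intro: square_integrable_mult)

lemma L2_interval_add:
  "f \<in> L2_interval l \<Longrightarrow> g \<in> L2_interval l \<Longrightarrow> (\<lambda>x. f x + g x) \<in> L2_interval l"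
  unfolding L2_interval_def by (auto intro: square_integrable_add)

lemma L2_interval_scale: "f \<in> L2_interval l \<Longrightarrow> (\<lambda>x. c * f x) \<in> L2_interval l"
  unfolding L2_interval_def by (auto simp: power_mult_distrib)

lemma L2_add: "f \<in> L2 G \<Longrightarrow> g \<in> L2 G \<Longrightarrow> (\<lambda>e x. f e x + g e x) \<in> L2 G"
  unfolding L2_def by (simp add: L2_interval_add)

lemma L2_scale: "f \<in> L2 G \<Longrightarrow> (\<lambda>e x. c * f e x) \<in> L2 G"
  unfolding L2_def by (simp add: L2_interval_scale)

lemma L2_diff: "f \<in> L2 G \<Longrightarrow> g \<in> L2 G \<Longrightarrow> (\<lambda>e x. f e x - g e x) \<in> L2 G"
  using L2_add[of f G "\<lambda>e x. -1 * g e x"] L2_scale[of g G "-1"] by simp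

lemma L2_const: "(\<lambda>e x. c) \<in> L2 G"
  unfolding L2_def by (simp add: L2_interval_continuous)

lemma L2_sum: "(\<And>i. i \<in> A \<Longrightarrow> h i \<in> L2 G) \<Longrightarrow> (\<lambda>e x. \<Sum>i\<in>A. h i e x) \<in> L2 G"
  by (induction A rule: infinite_finite_induct) (simp_all add: L2_const L2_add)

lemma L2_inner_commute: "L2_inner G f g = L2_inner G g f"
  unfolding L2_inner_def by (simp add: mult.commute)

lemma L2_inner_scale_left: "L2_inner G (\<lambda>e x. c * f e x) g = c * L2_inner G f g"
  unfolding L2_inner_def by (simp add: sum_distrib_left mult.assoc)

lemma L2_inner_add_left:
  assumes "f \<in> L2 G" "g \<in> L2 G" "h \<in> L2 G"
  shows "L2_inner G (\<lambda>e x. f e x + g e x) h = L2_inner G f h + L2_inner G g h"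
  using assms unfolding L2_inner_def L2_def
  by (simp add: distrib_right L2_interval_mult_integrable sum.distrib)

lemma L2_inner_diff_left:
  assumes "f \<in> L2 G" "g \<in> L2 G" "h \<in> L2 G"
  shows "L2_inner G (\<lambda>e x. f e x - g e x) h = L2_inner G f h - L2_inner G g h"
  using L2_inner_add_left[of f G "\<lambda>e x. -1 * g e x" h] L2_scale[of g G "-1"]
    L2_inner_scale_left[of G "-1" g h] assms by simp

lemma L2_inner_sum_left:
  assumes "\<And>i. i \<in> A \<Longrightarrow> h i \<in> L2 G" "g \<in> L2 G"
  shows "L2_inner G (\<lambda>e x. \<Sum>i\<in>A. h i e x) g = (\<Sum>i\<in>A. L2_inner G (h i) g)"
  using assms
proof (induction A rule: infinite_finite_induct)
  case (insert a A)
  then show ?case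
    by (simp add: L2_inner_add_left L2_sum)
qed (simp_all add: L2_inner_def)

lemma L2_inner_nonneg: "0 \<le> L2_inner G f f"
  unfolding L2_inner_def by (intro sum_nonneg) simp

text \<open>The quadratic polynomial in \<open>t\<close> whose nonnegativity yields the
  Cauchy-Schwarz inequality.\<close>

lemma L2_inner_diff_scale_self:
  assumes "f \<in> L2 G" "g \<in> L2 G"
  shows "L2_inner G (\<lambda>e x. f e x - t * g e x) (\<lambda>e x. f e x - t * g e x)
      = L2_inner G f f - 2 * t * L2_inner G f g + t\<^sup>2 * L2_inner G g g"
proof -
  let ?d = "\<lambda>e x. f e x - t * g e x"
  note L2 = assms L2_scale[OF assms(2), of t] L2_diff[OF assms(1) L2_scale[OF assms(2), of t]]
  have "L2_inner G ?d h = L2_inner G f h - t * L2_inner G g h" if "h \<in> L2 G" for h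
    using L2 that by (simp add: L2_inner_diff_left L2_inner_scale_left)
  note * = this[OF L2(4)] this[OF L2(1)] this[OF L2(2)]
  show ?thesis
    using * L2_inner_commute[of G f ?d] L2_inner_commute[of G g ?d] L2_inner_commute[of G g f]
    by (simp add: algebra_simps power2_eq_square)
qed

text \<open>Discriminant argument. Functions are not identified modulo null sets, so the form is
  only semidefinite and a \<open>g\<close> of norm zero is treated separately.\<close>

lemma L2_inner_Cauchy_Schwarz:
  assumes "f \<in> L2 G" "g \<in> L2 G"
  shows "\<bar>L2_inner G f g\<bar> \<le> sqrt (L2_inner G f f) * sqrt (L2_inner G g g)"
proof -
  define p q r where "p = L2_inner G f f" and "q = L2_inner G f g" and "r = L2_inner G g g"
  have nonneg: "0 \<le> p - 2 * t * q + t\<^sup>2 * r" for t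
    unfolding p_def q_def r_def
    using L2_inner_nonneg[of G "\<lambda>e x. f e x - t * g e x"] L2_inner_diff_scale_self[OF assms, of t]
    by simp
  have "q\<^sup>2 \<le> p * r"
  proof (cases "r = 0")
    case True
    have "q = 0"
    proof (rule ccontr)
      assume "q \<noteq> 0"
      then show False
        \<comment> \<open>For \<open>r = 0\<close> the polynomial is affine in \<open>t\<close>, and
          this \<open>t\<close> gives it the value -1.\<close>
        using nonneg[of "(p + 1) / (2 * q)"] True by simp
    qed
    then show ?thesis using True by simp
  next
    case False
    then have "0 < r"
      using L2_inner_nonneg[of G g] by (simp add: r_def)
    \<comment> \<open>The value \<open>q / r\<close> is the minimiser of the polynomial.\<close>
    then have "0 \<le> (p - 2 * (q / r) * q + (q / r)\<^sup>2 * r) * r"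
      using nonneg[of "q / r"] by simp
    also have "\<dots> = p * r - q\<^sup>2"
      using \<open>0 < r\<close> by (simp add: field_simps power2_eq_square)
    finally show ?thesis by simp
  qed
  then have "sqrt (q\<^sup>2) \<le> sqrt (p * r)" by (rule real_sqrt_le_mono)
  then show ?thesis
    by (simp add: real_sqrt_mult p_def q_def r_def)
qed

text \<open>A vanishing finite sum of nonnegative edge integrals has vanishing terms. Finiteness
  matters because a sum over an infinite set is 0 by default.\<close>

lemma L2_inner_self_eq_0:
  assumes "finite (edges G)" "f \<in> L2 G" "L2_inner G f f = 0"
  shows "AE_equal G f (\<lambda>e x. 0)"
  unfolding AE_equal_def
proof
  fix e assume e: "e \<in> edges G"
  have "\<forall>e\<in>edges G. (LINT x|edge_measure G e. f e x * f e x) = 0"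
    using assms(1,3) unfolding L2_inner_def by (subst (asm) sum_nonneg_eq_0_iff) auto
  with e have "(LINT x|edge_measure G e. f e x * f e x) = 0" by blast
  moreover have "integrable (edge_measure G e) (\<lambda>x. f e x * f e x)"
    using assms(2) e unfolding L2_def by (simp add: L2_interval_mult_integrable)
  ultimately show "AE x in edge_measure G e. f e x = 0"
    by (simp add: integral_nonneg_eq_0_iff_AE)
qed

lemma L2_inner_AE_equal_0:
  assumes "AE_equal G f (\<lambda>e x. 0)"
  shows "L2_inner G f g = 0"
  unfolding L2_inner_def
proof (rule sum.neutral, rule)
  fix e assume "e \<in> edges G"
  then have "AE x in edge_measure G e. f e x * g e x = 0"
    using assms unfolding AE_equal_def by (auto elim: eventually_mono)
  then show "(LINT x|edge_measure G e. f e x * g e x) = 0"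
    by (rule integral_eq_zero_AE)
qed

section \<open>Series converging in the mean square norm\<close>

text \<open>Continuity of the inner product: by Cauchy-Schwarz the remainder paired with
  \<open>g\<close> is at most its norm times that of \<open>g\<close>.\<close>

lemma L2_sums_inner:
  assumes "L2_sums G h f" "g \<in> L2 G"
  shows "(\<lambda>n. L2_inner G (h n) g) sums L2_inner G f g"
proof -
  define r where "r N = (\<lambda>e x. f e x - (\<Sum>n<N. h n e x))" for N
  have h: "\<And>n. h n \<in> L2 G" and f: "f \<in> L2 G"
    and lim: "(\<lambda>N. sqrt (L2_inner G (r N) (r N))) \<longlonglongrightarrow> 0"
    using assms(1) unfolding L2_sums_def r_def Let_def by auto
  have S: "(\<lambda>e x. \<Sum>n<N. h n e x) \<in> L2 G" for N
    using h by (intro L2_sum)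
  have r: "r N \<in> L2 G" for N
    unfolding r_def by (rule L2_diff[OF f S])
  have eq: "L2_inner G (r N) g = L2_inner G f g - (\<Sum>n<N. L2_inner G (h n) g)" for N
    unfolding r_def using L2_inner_diff_left[OF f S assms(2)] L2_inner_sum_left[of "{..<N}" h G g] h assms(2)
    by simp
  have "(\<lambda>N. sqrt (L2_inner G (r N) (r N)) * sqrt (L2_inner G g g)) \<longlonglongrightarrow> 0"
    using tendsto_mult_left_zero[OF lim] .
  then have "(\<lambda>N. L2_inner G (r N) g) \<longlonglongrightarrow> 0"
    by (rule Lim_null_comparison[rotated])
      (use L2_inner_Cauchy_Schwarz[OF r assms(2)] in simp)
  then have "(\<lambda>N. L2_inner G f g - L2_inner G (r N) g) \<longlonglongrightarrow> L2_inner G f g - 0"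
    by (intro tendsto_intros)
  then show ?thesis
    unfolding sums_def eq by simp
qed

text \<open>Orthonormality turns the squared norm of a block of the series into a block of the sum
  of \<open>(c n)^2\<close>, so the partial sums are Cauchy. Completeness is used edge by edge, and
  the finitely many limits are assembled into one function.\<close>

lemma Riesz_Fischer:
  assumes fin: "finite (edges G)" and phi: "\<And>n. phi n \<in> L2 G"
    and orth: "\<And>m n. L2_inner G (phi m) (phi n) = (if m = n then 1 else 0)"
    and summ: "summable (\<lambda>n. (c n)\<^sup>2)"
  obtains f where "L2_sums G (\<lambda>n e x. c n * phi n e x) f"
proof -
  define s where "s N e x = (\<Sum>n<N. c n * phi n e x)" for N e x
  have cphi: "(\<lambda>e x. c n * phi n e x) \<in> L2 G" for n
    by (rule L2_scale[OF phi])
  have s: "s N \<in> L2 G" for N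
    unfolding s_def by (rule L2_sum[OF cphi])
  have norm_block: "L2_inner G (\<lambda>e x. \<Sum>n\<in>A. c n * phi n e x) (\<lambda>e x. \<Sum>n\<in>A. c n * phi n e x)
      = (\<Sum>n\<in>A. (c n)\<^sup>2)" if "finite A" for A
  proof -
    let ?S = "\<lambda>e x. \<Sum>n\<in>A. c n * phi n e x"
    have S: "?S \<in> L2 G" by (rule L2_sum[OF cphi])
    have "L2_inner G (phi n) ?S = c n" if "n \<in> A" for n
    proof -
      have "L2_inner G (phi n) ?S = (\<Sum>m\<in>A. L2_inner G (\<lambda>e x. c m * phi m e x) (phi n))"
        by (subst L2_inner_commute) (rule L2_inner_sum_left[OF cphi phi])
      also have "\<dots> = c n"
        using \<open>finite A\<close> that by (simp add: L2_inner_scale_left orth if_distrib[of "(*) _"] cong: if_cong)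
      finally show ?thesis .
    qed
    moreover have "L2_inner G ?S ?S = (\<Sum>n\<in>A. L2_inner G (\<lambda>e x. c n * phi n e x) ?S)"
      by (rule L2_inner_sum_left[OF cphi S])
    ultimately show ?thesis
      by (simp add: L2_inner_scale_left power2_eq_square)
  qed
  have Cauchy: "\<exists>N. \<forall>m\<ge>N. \<forall>n\<ge>N. L2_inner G (\<lambda>e x. s m e x - s n e x) (\<lambda>e x. s m e x - s n e x) < \<epsilon>"
    if "0 < \<epsilon>" for \<epsilon>
  proof -
    obtain N where N: "\<And>m n. m \<ge> N \<Longrightarrow> norm (\<Sum>i=m..<n. (c i)\<^sup>2) < \<epsilon>"
      using summ \<open>0 < \<epsilon>\<close> unfolding summable_Cauchy by blast
    let ?P = "\<lambda>m n. L2_inner G (\<lambda>e x. s m e x - s n e x) (\<lambda>e x. s m e x - s n e x)"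
    have le: "?P m n < \<epsilon>" if "n \<ge> N" "m \<ge> n" for m n
    proof -
      have "s m e x - s n e x = (\<Sum>i=n..<m. c i * phi i e x)" for e x
        unfolding s_def using sum_diff_nat_ivl[of 0 n m "\<lambda>i. c i * phi i e x"] \<open>m \<ge> n\<close>
        by (simp add: lessThan_atLeast0)
      then have "?P m n = (\<Sum>i=n..<m. (c i)\<^sup>2)"
        by (simp add: norm_block)
      then show ?thesis
        using N[OF \<open>n \<ge> N\<close>, of m] by simp
    qed
    have "?P m n = ?P n m" for m n
      unfolding L2_inner_def by (simp add: algebra_simps)
    then have "?P m n < \<epsilon>" if "n \<ge> N" "m \<ge> N" for m n
      using le[of n m] le[of m n] that by (cases "n \<le> m") auto
    then show ?thesis by blast
  qed
  have "\<exists>g. g \<in> L2_interval (edge_length G e) \<and>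
      (\<lambda>N. LINT x|edge_measure G e. (g x - s N e x)\<^sup>2) \<longlonglongrightarrow> 0" if e: "e \<in> edges G" for e
  proof -
    interpret finite_measure "edge_measure G e"
      by (rule finite_measure_lebesgue_on) simp
    have se: "s N e \<in> L2_interval (edge_length G e)" for N
      using s e unfolding L2_def by blast
    \<comment> \<open>One edge contributes at most the whole squared norm, so the Cauchy property
      passes to each edge.\<close>
    have edge_le: "(LINT x|edge_measure G e. (s m e x - s n e x)\<^sup>2)
        \<le> L2_inner G (\<lambda>e x. s m e x - s n e x) (\<lambda>e x. s m e x - s n e x)" for m n
      unfolding L2_inner_def power2_eq_square using fin e
      by (intro member_le_sum[of e "edges G" "\<lambda>e. LINT x|edge_measure G e. (s m e x - s n e x) * (s m e x - s n e x)"])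
        auto
    show ?thesis
    proof (rule square_integrable_complete[of "\<lambda>N. s N e"])
      show "s N e \<in> borel_measurable (edge_measure G e)"
        "integrable (edge_measure G e) (\<lambda>x. (s N e x)\<^sup>2)" for N
        using se unfolding L2_interval_def by blast+
    next
      fix \<epsilon> :: real assume "0 < \<epsilon>"
      then show "\<exists>N. \<forall>m\<ge>N. \<forall>n\<ge>N. (LINT x|edge_measure G e. (s m e x - s n e x)\<^sup>2) < \<epsilon>"
        using Cauchy[of \<epsilon>] edge_le by (meson le_less_trans)
    qed (auto simp: L2_interval_def)
  qed
  then have "\<exists>f. \<forall>e\<in>edges G. f e \<in> L2_interval (edge_length G e) \<and>
      (\<lambda>N. LINT x|edge_measure G e. (f e x - s N e x)\<^sup>2) \<longlonglongrightarrow> 0"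
    by (intro bchoice ballI)
  then obtain f where f: "\<And>e. e \<in> edges G \<Longrightarrow> f e \<in> L2_interval (edge_length G e)"
    and lim: "\<And>e. e \<in> edges G \<Longrightarrow> (\<lambda>N. LINT x|edge_measure G e. (f e x - s N e x)\<^sup>2) \<longlonglongrightarrow> 0"
    by blast
  have "(\<lambda>N. \<Sum>e\<in>edges G. LINT x|edge_measure G e. (f e x - s N e x)\<^sup>2) \<longlonglongrightarrow> 0"
    using tendsto_sum[OF lim] by simp
  then have "(\<lambda>N. sqrt (\<Sum>e\<in>edges G. LINT x|edge_measure G e. (f e x - s N e x)\<^sup>2)) \<longlonglongrightarrow> sqrt 0"
    by (rule tendsto_real_sqrt)
  then have "L2_sums G (\<lambda>n e x. c n * phi n e x) f"
    unfolding L2_sums_def L2_inner_def Let_def using cphi f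
    by (simp add: s_def L2_def power2_eq_square)
  then show ?thesis by (rule that)
qed

text \<open>Pairing the series with \<open>phi m\<close> leaves a single nonzero term.\<close>

lemma L2_sums_orthonormal_coeff:
  assumes phi: "\<And>n. phi n \<in> L2 G"
    and orth: "\<And>m n. L2_inner G (phi m) (phi n) = (if m = n then 1 else 0)"
    and "L2_sums G (\<lambda>n e x. c n * phi n e x) f"
  shows "L2_inner G f (phi m) = c m"
proof -
  have "(\<lambda>n. L2_inner G (\<lambda>e x. c n * phi n e x) (phi m)) sums L2_inner G f (phi m)"
    by (rule L2_sums_inner[OF assms(3) phi])
  moreover have "(\<lambda>n. L2_inner G (\<lambda>e x. c n * phi n e x) (phi m)) = (\<lambda>n. if n = m then c n else 0)"
    by (auto simp: L2_inner_scale_left orth)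
  ultimately show ?thesis
    using sums_single[of m c] sums_unique2 by metis
qed

section \<open>Positivity of the eigenvalues\<close>

text \<open>The eigenvalue equation improves regularity: \<open>f''\<close> agrees almost everywhere
  with the continuous function \<open>- k * f\<close>, so \<open>f'\<close> is classically
  differentiable. The product \<open>f * f'\<close> is then an antiderivative of the integrand,
  which gives Green's identity by the fundamental theorem of calculus.\<close>

lemma H2_interval_eigenfunction_identity:
  assumes H2: "H2_interval l f f' f''" and "0 \<le> l"
    and eig: "AE x in lebesgue_on {0..l}. k * f x = - f'' x"
  shows "((\<lambda>x. (f' x)\<^sup>2 - k * (f x)\<^sup>2) has_integral f l * f' l - f 0 * f' 0) {0..l}"
    and "continuous_on {0..l} f'"
proof -
  have f: "(f has_real_derivative f' x) (at x within {0..l})" if "x \<in> {0..l}" for x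
    using H2 that unfolding H2_interval_def by blast
  have cf: "continuous_on {0..l} f"
    by (rule H2_interval_continuous[OF H2])
  \<comment> \<open>Changing the density on a null set leaves the integral unchanged; the new
    integrand is continuous, so its integral can be differentiated at every point.\<close>
  have f'_eq: "f' x = f' 0 + integral {0..x} (\<lambda>t. - k * f t)" if x: "x \<in> {0..l}" for x
  proof -
    have cx: "continuous_on {0..x} f"
      using cf x by (auto intro: continuous_on_subset)
    have m1: "f'' \<in> borel_measurable (lebesgue_on {0..x})"
    proof (rule measurable_restrict_mono)
      show "f'' \<in> borel_measurable (lebesgue_on {0..l})"
        using H2 unfolding H2_interval_def L2_interval_def by blast
      show "{0..x} \<subseteq> {0..l}" using x by simp
    qed
    have m2: "(\<lambda>t. - k * f t) \<in> borel_measurable (lebesgue_on {0..x})"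
      by (intro continuous_imp_measurable_on_sets_lebesgue continuous_intros cx) auto
    have "AE t in lebesgue_on {0..x}. f'' t = - k * f t"
    proof -
      have "AE t in lebesgue. t \<in> {0..l} \<longrightarrow> k * f t = - f'' t"
        using eig by (simp add: AE_restrict_space_iff)
      then have "AE t in lebesgue. t \<in> {0..x} \<longrightarrow> f'' t = - k * f t"
        by eventually_elim (use x in auto)
      then show ?thesis by (simp add: AE_restrict_space_iff)
    qed
    then have "(LINT t|lebesgue_on {0..x}. f'' t) = (LINT t|lebesgue_on {0..x}. - k * f t)"
      using m1 m2 by (intro integral_cong_AE)
    also have "\<dots> = integral {0..x} (\<lambda>t. - k * f t)"
      by (intro lebesgue_integral_eq_integral continuous_imp_integrable_real continuous_intros cx) auto
    finally show ?thesis
      using H2 x unfolding H2_interval_def by metis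
  qed
  have f': "(f' has_real_derivative - k * f x) (at x within {0..l})" if x: "x \<in> {0..l}" for x
  proof (rule has_field_derivative_transform_within[OF _ zero_less_one x])
    show "((\<lambda>x. f' 0 + integral {0..x} (\<lambda>t. - k * f t)) has_real_derivative - k * f x) (at x within {0..l})"
      using DERIV_add[OF DERIV_const integral_has_real_derivative[OF continuous_on_mult_left[OF cf] x, of "-k"]]
      by (simp only: add_0_left)
  qed (rule f'_eq[symmetric])
  then show "continuous_on {0..l} f'"
    by (meson DERIV_continuous continuous_on_eq_continuous_within)
  show "((\<lambda>x. (f' x)\<^sup>2 - k * (f x)\<^sup>2) has_integral f l * f' l - f 0 * f' 0) {0..l}"
  proof (rule fundamental_theorem_of_calculus[OF \<open>0 \<le> l\<close>])
    fix x assume "x \<in> {0..l}"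
    from DERIV_mult[OF f[OF this] f'[OF this]]
    show "((\<lambda>x. f x * f' x) has_vector_derivative (f' x)\<^sup>2 - k * (f x)\<^sup>2) (at x within {0..l})"
      by (simp add: has_real_derivative_iff_has_vector_derivative power2_eq_square algebra_simps)
  qed
qed

text \<open>Well-formedness puts every edge end at exactly one vertex, so the ends at the vertices
  partition all ends. Keeping ends apart from edges counts a loop twice at its vertex.\<close>

lemma sum_ends_grouped:
  assumes "fin_digraph (skeleton G)"
  shows "(\<Sum>v\<in>verts (skeleton G). \<Sum>p\<in>ends_at G v. h p)
       = (\<Sum>e\<in>edges G. h (e, True) + h (e, False))"
proof -
  interpret fin_digraph "skeleton G" by fact
  define g where "g = (\<lambda>(e, b). if b then head (skeleton G) e else tail (skeleton G) e)"
  have ends: "ends_at G v = {p \<in> edges G \<times> UNIV. g p = v}" for v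
    unfolding ends_at_def g_def by auto
  have "(\<Sum>v\<in>verts (skeleton G). \<Sum>p\<in>ends_at G v. h p) = sum h (edges G \<times> (UNIV :: bool set))"
    unfolding ends by (rule sum.group) (auto simp: g_def)
  also have "\<dots> = (\<Sum>e\<in>edges G. \<Sum>b\<in>UNIV. h (e, b))"
    by (simp add: sum.cartesian_product)
  also have "\<dots> = (\<Sum>e\<in>edges G. h (e, True) + h (e, False))"
    by (simp add: UNIV_bool add.commute)
  finally show ?thesis .
qed

text \<open>The contradiction treats zero and negative \<open>k\<close> together: the energy of
  \<open>f\<close> equals \<open>k\<close> times its squared norm, hence is at most 0, and forces
  \<open>f\<close> to vanish.\<close>

lemma neg_laplacian_eigenvalue_pos:
  assumes G: "compact_metric_graph G" and conn: "Digraph_Component.connected (skeleton G)"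
    and dir: "dirichlet G \<noteq> {}"
    and eig: "neg_laplacian G f (\<lambda>e x. k * f e x)" and nz: "L2_inner G f f \<noteq> 0"
  shows "0 < k"
proof (rule ccontr)
  assume "\<not> 0 < k"
  let ?V = "verts (skeleton G)"
  have fin: "fin_digraph (skeleton G)" and len: "\<And>e. e \<in> edges G \<Longrightarrow> 0 < edge_length G e"
    and dirV: "dirichlet G \<subseteq> ?V"
    using G unfolding compact_metric_graph_def by auto
  interpret fin_digraph "skeleton G" by (rule fin)
  obtain f' f'' where
      H2: "\<And>e. e \<in> edges G \<Longrightarrow> H2_interval (edge_length G e) (f e) (f' e) (f'' e)"
    and cont: "\<And>v p q. v \<in> ?V \<Longrightarrow> p \<in> ends_at G v \<Longrightarrow> q \<in> ends_at G v \<Longrightarrow>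
        end_value G f p = end_value G f q"
    and Dir: "\<And>v p. v \<in> dirichlet G \<Longrightarrow> p \<in> ends_at G v \<Longrightarrow> end_value G f p = 0"
    and Kir: "\<And>v. v \<in> ?V - dirichlet G \<Longrightarrow> (\<Sum>p\<in>ends_at G v. inward_deriv G f' p) = 0"
    and AE: "\<And>e. e \<in> edges G \<Longrightarrow> AE x in edge_measure G e. k * f e x = - f'' e x"
    using eig unfolding neg_laplacian_def AE_equal_def by (elim exE conjE) (rule that, blast+)
  have f_deriv: "(f e has_real_derivative f' e x) (at x within {0..edge_length G e})"
    if "e \<in> edges G" "x \<in> {0..edge_length G e}" for e x
    using H2[OF that(1)] that(2) unfolding H2_interval_def by blast
  have cf: "continuous_on {0..edge_length G e} (f e)" if "e \<in> edges G" for e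
    by (rule H2_interval_continuous[OF H2[OF that]])
  have cf': "continuous_on {0..edge_length G e} (f' e)" if "e \<in> edges G" for e
    using H2_interval_eigenfunction_identity(2)[OF H2 _ AE] that len[OF that] by simp
  \<comment> \<open>The sign in the inward derivative at parameter 0 absorbs the minus sign of the
    lower boundary term, so both ends enter alike.\<close>
  have edge: "integral {0..edge_length G e} (\<lambda>x. (f' e x)\<^sup>2) - k * (LINT x|edge_measure G e. f e x * f e x)
      = end_value G f (e, True) * inward_deriv G f' (e, True)
      + end_value G f (e, False) * inward_deriv G f' (e, False)" if e: "e \<in> edges G" for e
  proof -
    let ?I = "{0..edge_length G e}"
    have "((\<lambda>x. (f' e x)\<^sup>2 - k * (f e x)\<^sup>2) has_integral
        integral ?I (\<lambda>x. (f' e x)\<^sup>2) - k * integral ?I (\<lambda>x. (f e x)\<^sup>2)) ?I"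
      using cf[OF e] cf'[OF e]
      by (intro has_integral_diff has_integral_mult_right integrable_integral
          integrable_continuous_real continuous_intros)
    from has_integral_unique[OF this H2_interval_eigenfunction_identity(1)[OF H2[OF e] _ AE[OF e]]]
    have "integral ?I (\<lambda>x. (f' e x)\<^sup>2) - k * integral ?I (\<lambda>x. (f e x)\<^sup>2)
        = f e (edge_length G e) * f' e (edge_length G e) - f e 0 * f' e 0"
      using len[OF e] by simp
    moreover have "(LINT x|edge_measure G e. f e x * f e x) = integral ?I (\<lambda>x. (f e x)\<^sup>2)"
      unfolding power2_eq_square using cf[OF e]
      by (intro lebesgue_integral_eq_integral continuous_imp_integrable_real continuous_intros) auto
    ultimately show ?thesis by simp
  qed
  \<comment> \<open>At a Dirichlet vertex all end values vanish; elsewhere the common value factors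
    out of the Kirchhoff sum. A vertex without ends gives an empty sum.\<close>
  have vertex: "(\<Sum>p\<in>ends_at G v. end_value G f p * inward_deriv G f' p) = 0" if v: "v \<in> ?V" for v
  proof (cases "v \<in> dirichlet G")
    case True
    then show ?thesis using Dir by (intro sum.neutral) simp
  next
    case False
    show ?thesis
    proof (cases "ends_at G v = {}")
      case False
      then obtain q where q: "q \<in> ends_at G v" by blast
      have "(\<Sum>p\<in>ends_at G v. end_value G f p * inward_deriv G f' p)
          = end_value G f q * (\<Sum>p\<in>ends_at G v. inward_deriv G f' p)"
        unfolding sum_distrib_left using cont[OF v _ q] by (intro sum.cong) auto
      then show ?thesis using Kir v \<open>v \<notin> dirichlet G\<close> by simp
    qed simp
  qed
  have "(\<Sum>e\<in>edges G. integral {0..edge_length G e} (\<lambda>x. (f' e x)\<^sup>2)) - k * L2_inner G f f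
      = (\<Sum>e\<in>edges G. end_value G f (e, True) * inward_deriv G f' (e, True)
          + end_value G f (e, False) * inward_deriv G f' (e, False))"
    unfolding L2_inner_def sum_distrib_left sum_subtractf[symmetric] by (intro sum.cong edge refl)
  also have "\<dots> = (\<Sum>v\<in>?V. \<Sum>p\<in>ends_at G v. end_value G f p * inward_deriv G f' p)"
    by (rule sum_ends_grouped[OF fin, symmetric])
  also have "\<dots> = 0"
    using vertex by (intro sum.neutral) blast
  finally have energy: "(\<Sum>e\<in>edges G. integral {0..edge_length G e} (\<lambda>x. (f' e x)\<^sup>2)) = k * L2_inner G f f"
    by simp
  have nonneg: "0 \<le> integral {0..edge_length G e} (\<lambda>x. (f' e x)\<^sup>2)" if "e \<in> edges G" for e
    using cf'[OF that] by (intro integral_nonneg integrable_continuous_real continuous_intros) auto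
  have "k * L2_inner G f f \<le> 0"
    using \<open>\<not> 0 < k\<close> L2_inner_nonneg[of G f] by (simp add: mult_nonpos_nonneg)
  with energy nonneg have zero: "integral {0..edge_length G e} (\<lambda>x. (f' e x)\<^sup>2) = 0" if "e \<in> edges G" for e
  proof -
    have "integral {0..edge_length G e} (\<lambda>x. (f' e x)\<^sup>2)
        \<le> (\<Sum>e\<in>edges G. integral {0..edge_length G e} (\<lambda>x. (f' e x)\<^sup>2))"
      using that nonneg by (intro member_le_sum[of e "edges G"]) auto
    with nonneg[OF that] energy \<open>k * L2_inner G f f \<le> 0\<close> show ?thesis by linarith
  qed
  \<comment> \<open>Continuity of \<open>f'\<close> upgrades the vanishing integral to vanishing at
    every point of the edge.\<close>
  have const: "f e x = f e 0" if e: "e \<in> edges G" and x: "x \<in> {0..edge_length G e}" for e x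
  proof -
    have "(f' e y)\<^sup>2 = 0" if "y \<in> {0..edge_length G e}" for y
      using zero[OF e] integral_eq_0_iff[of 0 "edge_length G e" "\<lambda>x. (f' e x)\<^sup>2"]
        continuous_on_power[OF cf'[OF e], of 2] len[OF e] that
      by simp
    then have "\<exists>c. \<forall>y\<in>{0..edge_length G e}. f e y = c"
      using f_deriv[OF e] by (intro has_field_derivative_zero_constant) auto
    then show ?thesis using x len[OF e] by force
  qed
  obtain v0 where v0: "v0 \<in> dirichlet G" using dir by blast
  \<comment> \<open>Connectedness is strong connectedness of the symmetrised graph, so every vertex
    is reachable from \<open>v0\<close> and an induction along walks is available.\<close>
  interpret S: pair_wf_digraph "mk_symmetric (skeleton G)" ..
  have vanish: "\<forall>p\<in>ends_at G v. end_value G f p = 0" if v: "v \<in> ?V" for v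
  proof -
    have "v0 \<rightarrow>\<^sup>*\<^bsub>with_proj (mk_symmetric (skeleton G))\<^esub> v"
      using conn v v0 dirV unfolding Digraph_Component.connected_def strongly_connected_def by auto
    then show ?thesis
    proof (induction rule: S.reachable_induct)
      case base
      then show ?case using Dir v0 by blast
    next
      case (step u w)
      then have "(u, w) \<in> parcs (mk_symmetric (skeleton G))"
        by simp
      then obtain e where e: "e \<in> edges G"
        and "u = tail (skeleton G) e \<and> w = head (skeleton G) e \<or>
             u = head (skeleton G) e \<and> w = tail (skeleton G) e"
        unfolding parcs_mk_symmetric by blast
      \<comment> \<open>The walk may cross \<open>e\<close> in either direction, recorded by
        \<open>b\<close>. Constancy on \<open>e\<close> carries the value 0 to one end at
        \<open>w\<close>, and continuity at \<open>w\<close> spreads it to all ends there.\<close>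
      then have "\<exists>b. (e, b) \<in> ends_at G u \<and> (e, \<not> b) \<in> ends_at G w"
        unfolding ends_at_def by (auto simp: ex_bool_eq)
      then obtain b where u: "(e, b) \<in> ends_at G u" and w: "(e, \<not> b) \<in> ends_at G w"
        by blast
      have "end_value G f (e, \<not> b) = end_value G f (e, b)"
        using const[OF e, of "edge_length G e"] len[OF e] by simp
      moreover have "end_value G f (e, b) = 0" using step.IH u by blast
      moreover have "w \<in> ?V" using w unfolding ends_at_def by (auto split: if_splits)
      ultimately show ?case using cont w by metis
    qed
  qed
  have "f e x = 0" if e: "e \<in> edges G" and x: "x \<in> {0..edge_length G e}" for e x
  proof -
    have "(e, False) \<in> ends_at G (tail (skeleton G) e)" "tail (skeleton G) e \<in> ?V"
      using e unfolding ends_at_def by auto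
    then have "end_value G f (e, False) = 0" using vanish by blast
    then show ?thesis using const[OF e x] by simp
  qed
  then have "AE_equal G f (\<lambda>e x. 0)"
    unfolding AE_equal_def by (auto intro!: AE_I2)
  with nz show False by (simp add: L2_inner_AE_equal_0)
qed

section \<open>The fractional torsion function\<close>

lemma neg_laplacian_L2: "neg_laplacian G f g \<Longrightarrow> f \<in> L2 G"
  unfolding neg_laplacian_def L2_def by (blast intro: L2_interval_continuous H2_interval_continuous)

lemma graph_integral_eq_inner: "graph_integral G f = L2_inner G f (\<lambda>e x. 1)"
  unfolding graph_integral_def L2_inner_def by simp

text \<open>Connectedness and the presence of Dirichlet vertices are represented here by
  \<open>lam_pos\<close>, which \<open>neg_laplacian_eigenvalue_pos\<close> supplies.\<close>

locale eigenbasis =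
  fixes G :: "('v, 'e) metric_graph" and lam :: "nat \<Rightarrow> real" and phi :: "nat \<Rightarrow> 'e \<Rightarrow> real \<Rightarrow> real"
  assumes graph: "compact_metric_graph G"
    and basis: "laplacian_eigenbasis G lam phi"
    and lam_pos: "\<And>n. 0 < lam n"
begin

lemma phi_L2: "phi n \<in> L2 G"
  using basis neg_laplacian_L2 unfolding laplacian_eigenbasis_def by blast

lemma orthonormal: "L2_inner G (phi m) (phi n) = (if m = n then 1 else 0)"
  using basis unfolding laplacian_eigenbasis_def by blast

lemma finite_edges: "finite (edges G)"
  using graph unfolding compact_metric_graph_def by (blast intro: fin_digraph.finite_arcs)

lemma expansion: "f \<in> L2 G \<Longrightarrow> L2_sums G (\<lambda>n e x. L2_inner G f (phi n) * phi n e x) f"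
  using basis unfolding laplacian_eigenbasis_def by blast

lemma Parseval:
  assumes "f \<in> L2 G" "g \<in> L2 G"
  shows "(\<lambda>n. L2_inner G f (phi n) * L2_inner G g (phi n)) sums L2_inner G f g"
  using L2_sums_inner[OF expansion[OF assms(1)] assms(2)]
  by (simp add: L2_inner_scale_left L2_inner_commute[of G g])

lemma coeff:
  "L2_sums G (\<lambda>n e x. c n * phi n e x) f \<Longrightarrow> L2_inner G f (phi m) = c m"
  by (rule L2_sums_orthonormal_coeff[OF phi_L2 orthonormal])

text \<open>The inverse divides the coefficients of \<open>g\<close> by the powers of the
  eigenvalues. These divisors are bounded away from 0 because \<open>lam 0\<close> is the least
  eigenvalue and positive, so Riesz-Fischer applies.\<close>

lemma frac_laplacian_inverse_exists:
  assumes "0 < \<alpha>" "g \<in> L2 G"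
  shows "\<exists>u. frac_laplacian G lam phi \<alpha> u g"
proof -
  define c where "c n = lam n powr (- \<alpha>) * L2_inner G g (phi n)" for n
  have bsq: "summable (\<lambda>n. (L2_inner G g (phi n))\<^sup>2)"
    using Parseval[OF assms(2) assms(2)] by (auto simp: sums_iff power2_eq_square)
  have "(c n)\<^sup>2 \<le> (lam 0 powr (- \<alpha>))\<^sup>2 * (L2_inner G g (phi n))\<^sup>2" for n
  proof -
    have "lam 0 \<le> lam n"
      using basis unfolding laplacian_eigenbasis_def by (simp add: incseqD)
    then have "lam n powr (- \<alpha>) \<le> lam 0 powr (- \<alpha>)"
      using lam_pos[of 0] \<open>0 < \<alpha>\<close> by (intro powr_mono2') auto
    then show ?thesis
      unfolding c_def power_mult_distrib by (intro mult_right_mono power_mono) auto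
  qed
  then have "summable (\<lambda>n. (c n)\<^sup>2)"
    by (intro summable_comparison_test'[OF summable_mult[OF bsq]]) simp
  then obtain u where u: "L2_sums G (\<lambda>n e x. c n * phi n e x) u"
    using Riesz_Fischer[OF finite_edges phi_L2 orthonormal] by blast
  have eq: "lam n powr \<alpha> * L2_inner G u (phi n) = L2_inner G g (phi n)" for n
    using lam_pos[of n] by (simp add: coeff[OF u] c_def powr_minus)
  have "lam n powr (2 * \<alpha>) * (L2_inner G u (phi n))\<^sup>2 = (L2_inner G g (phi n))\<^sup>2" for n
    unfolding eq[symmetric] power_mult_distrib by (simp add: power2_eq_square flip: powr_add)
  moreover have "u \<in> L2 G"
    using u unfolding L2_sums_def by blast
  ultimately show ?thesis
    using bsq expansion[OF assms(2)] unfolding frac_laplacian_def frac_laplacian_domain_def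
    by (auto simp: eq)
qed

section \<open>Variational properties of an arbitrary representative of the torsion function\<close>

context
  fixes \<alpha> :: real and u :: "'e \<Rightarrow> real \<Rightarrow> real"
  assumes alpha: "0 < \<alpha>" and torsion: "frac_laplacian G lam phi \<alpha> u (\<lambda>e x. 1)"
begin

lemma torsion_L2: "u \<in> L2 G"
  using torsion unfolding frac_laplacian_def frac_laplacian_domain_def by blast

lemma torsion_coeff: "lam n powr \<alpha> * L2_inner G u (phi n) = L2_inner G (\<lambda>e x. 1) (phi n)"
proof -
  have "L2_sums G (\<lambda>n e x. lam n powr \<alpha> * L2_inner G u (phi n) * phi n e x) (\<lambda>e x. 1)"
    using torsion unfolding frac_laplacian_def by blast
  from coeff[OF this] show ?thesis by simp
qed

text \<open>The numbers \<open>lam n powr \<alpha> * L2_inner G u (phi n)\<close> are the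
  coefficients of the constant 1, so Parseval gives convergence for every \<open>f\<close> in
  \<open>L2 G\<close>.\<close>

lemma torsion_weak:
  assumes "f \<in> L2 G"
  shows "(\<lambda>n. lam n powr \<alpha> * (L2_inner G f (phi n) * L2_inner G u (phi n))) sums graph_integral G f"
  unfolding graph_integral_eq_inner
  using Parseval[OF assms L2_const[of 1]] by (simp add: torsion_coeff[symmetric] mult.left_commute)

text \<open>The weak equation tested with \<open>u\<close> itself: its convergence gives membership,
  its limit the value of the form.\<close>

lemma torsion_H0: "u \<in> H0_frac G lam phi \<alpha>"
  and form_torsion: "frac_form G lam phi \<alpha> u = graph_integral G u"
  using torsion_weak[OF torsion_L2] torsion_L2 unfolding H0_frac_def frac_form_def
  by (auto simp: power2_eq_square sums_iff)

text \<open>By Parseval a nonzero function has a nonzero coefficient, whose term in the form is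
  positive. The quotient thus never divides by 0.\<close>

lemma frac_form_pos:
  assumes "f \<in> admissible G lam phi \<alpha>"
  shows "0 < frac_form G lam phi \<alpha> f"
proof -
  have f: "f \<in> L2 G" and summ: "summable (\<lambda>n. lam n powr \<alpha> * (L2_inner G f (phi n))\<^sup>2)"
    and nz: "\<not> AE_equal G f (\<lambda>e x. 0)"
    using assms unfolding admissible_def H0_frac_def by auto
  obtain m where "L2_inner G f (phi m) \<noteq> 0"
  proof (rule ccontr)
    assume "\<not> thesis"
    then have "\<And>n. L2_inner G f (phi n) = 0" using that by blast
    then have "L2_inner G f f = 0"
      using Parseval[OF f f] by (simp add: sums_iff)
    then show False
      using L2_inner_self_eq_0[OF finite_edges f] nz by blast
  qed
  then show ?thesis
    unfolding frac_form_def using lam_pos[of m]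
    by (intro suminf_pos2[OF summ, of m]) auto
qed

lemma torsion_scale_admissible:
  assumes "c \<noteq> 0"
  shows "(\<lambda>e x. c * u e x) \<in> admissible G lam phi \<alpha>"
proof -
  have "\<not> AE_equal G (\<lambda>e x. c * u e x) (\<lambda>e x. 0)"
  proof
    assume "AE_equal G (\<lambda>e x. c * u e x) (\<lambda>e x. 0)"
    then have "AE_equal G u (\<lambda>e x. 0)"
      using \<open>c \<noteq> 0\<close> unfolding AE_equal_def by simp
    then have "L2_inner G (\<lambda>e x. 1) (phi n) = 0" for n
      by (simp add: torsion_coeff[symmetric] L2_inner_AE_equal_0)
    then have "L2_inner G (\<lambda>e x. 1) (\<lambda>e x. 1) = 0"
      using Parseval[OF L2_const[of 1] L2_const[of 1]] by (simp add: sums_iff)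
    then have "AE_equal G (\<lambda>e x. 1) (\<lambda>e x. 0)"
      by (rule L2_inner_self_eq_0[OF finite_edges L2_const])
    \<comment> \<open>If 1 = 0 almost everywhere, every function vanishes almost everywhere,
      contrary to \<open>phi 0\<close> having norm one. So the eigenbasis itself excludes a graph
      without edges.\<close>
    then have "AE_equal G (phi 0) (\<lambda>e x. 0)"
      unfolding AE_equal_def by (auto elim: eventually_mono)
    then show False
      using orthonormal[of 0 0] by (simp add: L2_inner_AE_equal_0)
  qed
  moreover have "(\<lambda>e x. c * u e x) \<in> H0_frac G lam phi \<alpha>"
    using torsion_H0 L2_scale[OF torsion_L2] summable_mult[of "\<lambda>n. lam n powr \<alpha> * (L2_inner G u (phi n))\<^sup>2" "c\<^sup>2"]
    unfolding H0_frac_def by (simp add: L2_inner_scale_left power_mult_distrib mult.left_commute)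
  ultimately show ?thesis unfolding admissible_def by blast
qed

lemma torsion_integral_pos: "0 < graph_integral G u"
  using frac_form_pos[OF torsion_scale_admissible[of 1]] by (simp add: form_torsion)

text \<open>Numerator and denominator are both homogeneous of degree 2, and at \<open>u\<close> the
  quotient is the square of the integral of \<open>u\<close> divided by that integral.\<close>

lemma polya_quotient_torsion_scale:
  assumes "c \<noteq> 0"
  shows "polya_quotient G lam phi \<alpha> (\<lambda>e x. c * u e x) = graph_integral G u"
proof -
  have "frac_form G lam phi \<alpha> (\<lambda>e x. c * u e x) = c\<^sup>2 * frac_form G lam phi \<alpha> u"
    using torsion_H0 suminf_mult[of "\<lambda>n. lam n powr \<alpha> * (L2_inner G u (phi n))\<^sup>2" "c\<^sup>2"]
    unfolding frac_form_def H0_frac_def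
    by (simp add: L2_inner_scale_left power_mult_distrib mult.left_commute)
  moreover have "graph_integral G (\<lambda>e x. c * u e x) = c * graph_integral G u"
    by (simp add: graph_integral_eq_inner L2_inner_scale_left)
  ultimately show ?thesis
    using assms torsion_integral_pos
    by (simp add: polya_quotient_def form_torsion power_mult_distrib power2_eq_square)
qed

text \<open>Expands \<open>0 \<le> frac_form (f - t u)\<close> at the minimising \<open>t = \<integral> f / \<integral> u\<close>.\<close>

lemma polya_quotient_le:
  assumes "f \<in> admissible G lam phi \<alpha>"
  shows "polya_quotient G lam phi \<alpha> f \<le> graph_integral G u"
proof -
  have f: "f \<in> L2 G" and summ: "summable (\<lambda>n. lam n powr \<alpha> * (L2_inner G f (phi n))\<^sup>2)"
    using assms unfolding admissible_def H0_frac_def by auto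
  define F T t where "F = graph_integral G f" and "T = graph_integral G u" and "t = F / T"
  have T: "0 < T" unfolding T_def by (rule torsion_integral_pos)
  let ?f = "\<lambda>n. L2_inner G f (phi n)" and ?u = "\<lambda>n. L2_inner G u (phi n)"
  have sums: "(\<lambda>n. lam n powr \<alpha> * (?f n)\<^sup>2 - 2 * t * (lam n powr \<alpha> * (?f n * ?u n))
        + t\<^sup>2 * (lam n powr \<alpha> * (?u n * ?u n))) sums
      (frac_form G lam phi \<alpha> f - 2 * t * F + t\<^sup>2 * T)"
    unfolding F_def T_def frac_form_def
    by (intro sums_add sums_diff sums_mult torsion_weak f torsion_L2 summable_sums summ)
  have "lam n powr \<alpha> * (?f n)\<^sup>2 - 2 * t * (lam n powr \<alpha> * (?f n * ?u n))
        + t\<^sup>2 * (lam n powr \<alpha> * (?u n * ?u n)) = lam n powr \<alpha> * (?f n - t * ?u n)\<^sup>2" for n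
    by (simp add: power2_eq_square algebra_simps)
  then have "0 \<le> frac_form G lam phi \<alpha> f - 2 * t * F + t\<^sup>2 * T"
    by (intro sums_le[OF _ sums_zero sums]) simp
  \<comment> \<open>At \<open>t = F / T\<close> the last two terms add up to
    \<open>- F^2 / T\<close>.\<close>
  then have "F\<^sup>2 / T \<le> frac_form G lam phi \<alpha> f"
    using T by (simp add: t_def power2_eq_square)
  then show ?thesis
    using T frac_form_pos[OF assms] by (simp add: polya_quotient_def F_def T_def field_simps)
qed

end

end

text \<open>Boundedness is part of the conclusion because a real supremum carries meaning only for a
  nonempty set bounded above. The eigenbasis is arbitrary, so the result covers every choice of
  orthonormal eigenfunctions.\<close>

theorem theorem5p4:
  fixes G :: "('v, 'e) metric_graph"
    and lam :: "nat \<Rightarrow> real" and phi :: "nat \<Rightarrow> 'e \<Rightarrow> real \<Rightarrow> real" and \<alpha> :: real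
  assumes "compact_metric_graph G"
    and "Digraph_Component.connected (skeleton G)"
    and "dirichlet G \<noteq> {}"
    and "laplacian_eigenbasis G lam phi"
    and "0 < \<alpha>" and "\<alpha> < 1"
  shows "bdd_above (polya_quotient G lam phi \<alpha> ` admissible G lam phi \<alpha>)
    \<and> frac_torsional_rigidity G lam phi \<alpha> = (SUP f\<in>admissible G lam phi \<alpha>. polya_quotient G lam phi \<alpha> f)
    \<and> (\<exists>f\<in>admissible G lam phi \<alpha>.
         polya_quotient G lam phi \<alpha> f = frac_torsional_rigidity G lam phi \<alpha> \<and>
         (\<forall>g\<in>admissible G lam phi \<alpha>. polya_quotient G lam phi \<alpha> g \<le> polya_quotient G lam phi \<alpha> f))
    \<and> frac_torsion_function G lam phi \<alpha> \<in> H0_frac G lam phi \<alpha>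
    \<and> (\<forall>c::real. c \<noteq> 0 \<longrightarrow>
         (\<lambda>e x. c * frac_torsion_function G lam phi \<alpha> e x) \<in> admissible G lam phi \<alpha> \<and>
         polya_quotient G lam phi \<alpha> (\<lambda>e x. c * frac_torsion_function G lam phi \<alpha> e x)
           = (SUP f\<in>admissible G lam phi \<alpha>. polya_quotient G lam phi \<alpha> f))"
proof -
  have "0 < lam n" for n
  proof (rule neg_laplacian_eigenvalue_pos[OF assms(1-3)])
    show "neg_laplacian G (phi n) (\<lambda>e x. lam n * phi n e x)" "L2_inner G (phi n) (phi n) \<noteq> 0"
      using assms(4) unfolding laplacian_eigenbasis_def by auto
  qed
  with assms(1,4) interpret eigenbasis G lam phi
    by unfold_locales
  let ?u = "frac_torsion_function G lam phi \<alpha>" and ?A = "admissible G lam phi \<alpha>"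
    and ?Q = "polya_quotient G lam phi \<alpha>"
  \<comment> \<open>Existence of a solution guarantees that the choice operator returns one.\<close>
  have u: "frac_laplacian G lam phi \<alpha> ?u (\<lambda>e x. 1)"
    unfolding frac_torsion_function_def
    using frac_laplacian_inverse_exists[OF assms(5) L2_const] by (rule someI_ex)
  note adm = torsion_scale_admissible[OF assms(5) u]
    and le = polya_quotient_le[OF assms(5) u]
    and quot = polya_quotient_torsion_scale[OF assms(5) u]
  have bdd: "bdd_above (?Q ` ?A)"
    by (rule bdd_aboveI2[OF le])
  have u_adm: "?u \<in> ?A" and u_quot: "?Q ?u = graph_integral G ?u"
    using adm[of 1] quot[of 1] by simp_all
  have sup: "(SUP f\<in>?A. ?Q f) = graph_integral G ?u"
  proof (rule antisym)
    show "(SUP f\<in>?A. ?Q f) \<le> graph_integral G ?u"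
      using u_adm by (intro cSUP_least le) auto
    show "graph_integral G ?u \<le> (SUP f\<in>?A. ?Q f)"
      using cSUP_upper[OF u_adm bdd] u_quot by simp
  qed
  have max: "\<exists>f\<in>?A. ?Q f = graph_integral G ?u \<and> (\<forall>g\<in>?A. ?Q g \<le> ?Q f)"
    using u_adm u_quot le by auto
  have "?u \<in> H0_frac G lam phi \<alpha>"
    by (rule torsion_H0[OF assms(5) u])
  with bdd sup max adm quot show ?thesis
    unfolding frac_torsional_rigidity_def by simp
qed

end
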